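(* For each $n$ let $\alpha$ be chosen uniformly at random from $\mathrm{UPF}_n$. Then, as $n\to\infty$, $\operatorname{fix}(\alpha)$ converges in distribution to a Poisson random variable of mean $1$: for every integer $r\ge0$, $$\Pr\bigl[\operatorname{fix}(\alpha)=r\bigr]\longrightarrow\frac{e^{-1}}{r!}.$$ In particular, the case $r=0$ is the limit $\widetilde F_n/F_n\to e^{-1}$.
   Context: $[n]=\{1,\dots,n\}$. $S(n,k)$ is the Stirling number of the second kind, $d_k$ is the number of derangements of $[k]$, $F_n=\sum_{k=0}^n k!\,S(n,k)$ (Fubini number), and $\widetilde F_n=\sum_{k=0}^n d_k S(n,k)$ (deranged Bell number). A tuple $\alpha=(a_1,\dots,a_n)\in[n]^n$ is a parking function if, when cars $1,\dots,n$ enter in this order a one-way street with spots $1,\dots,n$ and car $i$ parks in the first free spot $s_i\ge a_i$, all cars manage to park. $\mathrm{UPF}_n$ (unit-interval parking functions) is the set of parking functions of length $n$ with $s_i-a_i\in\{0,1\}$ for all $i$. Block structure: for $\alpha\in\mathrm{UPF}_n$ let $(a^\uparrow_1,\dots,a^\uparrow_n)$ be its weakly increasing rearrangement, let $\nu_1<\dots<\nu_m$ be the indices $i$ with $a^\uparrow_i=i$, and put $\nu_{m+1}=n+1$. The car set of block $j$ is $I_j=\{i\in[n]:\nu_j\le a_i<\nu_{j+1}\}$. Set $\phi(\alpha)=(I_1,\dots,I_m)$, an ordered set partition of $[n]$. For an ordered set partition $(C_1,\dots,C_k)$ of $[n]$ whose blocks listed by increasing minimum element are $B_1,\dots,B_k$,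 the block $C_i$ is fixed if $C_i=B_i$. $\operatorname{fix}(\alpha)$ is the number of fixed blocks of $\phi(\alpha)$. *)

theory Defs
  imports "HOL-Probability.Probability" "HOL-Combinatorics.Combinatorics"
begin

section \<open>Fubini numbers and deranged Bell numbers\<close>

definition derangement_number :: "nat \<Rightarrow> nat" where
  "derangement_number k = card {p. p permutes {1..k} \<and> (\<forall>i\<in>{1..k}. p i \<noteq> i)}"

definition fubini :: "nat \<Rightarrow> nat" where
  "fubini n = (\<Sum>k=0..n. fact k * Stirling n k)"

definition deranged_bell :: "nat \<Rightarrow> nat" where
  "deranged_bell n = (\<Sum>k=0..n. derangement_number k * Stirling n k)"


section \<open>Parking functions\<close>

text \<open>
  A tuple in \<open>[n]\<^sup>n\<close> is an extensional function on \<open>{1..n}\<close>; \<open>a i\<close> is the preferred spot of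
  car \<open>i\<close>. The predicate \<open>parks n a s\<close> says that every car \<open>i \<in> [n]\<close> finds a spot and that this
  spot is \<open>s i\<close>: the first spot in \<open>{a i..n}\<close> not taken by one of the cars \<open>1, \<dots>, i - 1\<close>.
\<close>

definition parks :: "nat \<Rightarrow> (nat \<Rightarrow> nat) \<Rightarrow> (nat \<Rightarrow> nat) \<Rightarrow> bool" where
  "parks n a s \<longleftrightarrow>
     (\<forall>i\<in>{1..n}. s i \<in> {a i..n} \<and> s i \<notin> s ` {1..<i} \<and> (\<forall>t\<in>{a i..<s i}. t \<in> s ` {1..<i}))"

text \<open>The outcome is unique, so it does not matter how it is quantified below.\<close>

lemma parks_unique:
  assumes "parks n a s" "parks n a t" "i \<in> {1..n}"
  shows "s i = t i"
  using assms(3)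
proof (induction i rule: less_induct)
  case (less i)
  have "s ` {1..<i} = t ` {1..<i}"
    by (rule image_cong) (use less in auto)
  moreover have "s i \<in> {a i..n}" "s i \<notin> s ` {1..<i}" "\<forall>u\<in>{a i..<s i}. u \<in> s ` {1..<i}"
    "t i \<in> {a i..n}" "t i \<notin> t ` {1..<i}" "\<forall>u\<in>{a i..<t i}. u \<in> t ` {1..<i}"
    using assms(1,2) less.prems unfolding parks_def by blast+
  ultimately show ?case
    by (metis atLeastAtMost_iff atLeastLessThan_iff linorder_neqE_nat)
qed

definition parking_functions :: "nat \<Rightarrow> (nat \<Rightarrow> nat) set" where
  "parking_functions n = {a \<in> {1..n} \<rightarrow>\<^sub>E {1..n}. \<exists>s. parks n a s}"

definition UPF :: "nat \<Rightarrow> (nat \<Rightarrow> nat) set" where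
  "UPF n = {a \<in> parking_functions n.
     \<exists>s. parks n a s \<and> (\<forall>i\<in>{1..n}. int (s i) - int (a i) \<in> {0, 1})}"

text \<open>These two facts make \<open>pmf_of_set (UPF n)\<close> the uniform distribution on \<open>UPF n\<close>.\<close>

lemma finite_UPF: "finite (UPF n)"
  unfolding UPF_def parking_functions_def by (simp add: finite_PiE)

lemma UPF_nonempty: "UPF n \<noteq> {}"
proof -
  let ?a = "restrict (\<lambda>i. i) {1..n}"
  have "parks n ?a (\<lambda>i. i)" by (auto simp: parks_def)
  then have "?a \<in> UPF n"
    unfolding UPF_def parking_functions_def by auto
  then show ?thesis by blast
qed


section \<open>Block structure\<close>

text \<open>Lists are 0-indexed, hence the shift by one.\<close>

definition rearranged :: "nat \<Rightarrow> (nat \<Rightarrow> nat) \<Rightarrow> nat \<Rightarrow> nat" where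
  "rearranged n a i = sort (map a [1..<Suc n]) ! (i - 1)"

text \<open>The list \<open>[\<nu>\<^sub>1, \<dots>, \<nu>\<^sub>m, \<nu>\<^sub>m\<^sub>+\<^sub>1]\<close>, where \<open>\<nu>\<^sub>m\<^sub>+\<^sub>1 = n + 1\<close>.\<close>

definition block_bounds :: "nat \<Rightarrow> (nat \<Rightarrow> nat) \<Rightarrow> nat list" where
  "block_bounds n a = sorted_list_of_set {i \<in> {1..n}. rearranged n a i = i} @ [n + 1]"

definition blocks :: "nat \<Rightarrow> (nat \<Rightarrow> nat) \<Rightarrow> nat set list" where
  "blocks n a =
     (let \<nu> = block_bounds n a
      in map (\<lambda>j. {i \<in> {1..n}. \<nu> ! j \<le> a i \<and> a i < \<nu> ! (j + 1)}) [0..<length \<nu> - 1])"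

text \<open>An ordered set partition is the list of its blocks.\<close>

definition num_fixed_blocks :: "nat set list \<Rightarrow> nat" where
  "num_fixed_blocks C = card {i. i < length C \<and> C ! i = sort_key Min C ! i}"

definition fix_count :: "nat \<Rightarrow> (nat \<Rightarrow> nat) \<Rightarrow> nat" where
  "fix_count n a = num_fixed_blocks (blocks n a)"

end

theory Submission
  imports Defs
begin

text \<open>
  In a unit-interval parking function the preferences, read in the order of the spots, are weakly
  increasing, so the \<open>\<nu>\<^sub>j\<close> are exactly the spots of the cars that got their preference. Between two
  such spots every car was displaced by the car parked just before it, so the cars of a block park
  in increasing order. Hence the outcome, and with it \<open>\<alpha>\<close>, can be read off the blocks, and
  \<open>\<phi>\<close> is a bijection onto the ordered set partitions of \<open>[n]\<close>. Ordering a partition into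
  \<open>k\<close> blocks amounts to choosing a permutation of \<open>[k]\<close>, whose fixed points are the fixed blocks,
  so \<open>Pr[fix = r]\<close> is an average over \<open>k\<close>, with weights \<open>k! S(n,k) / F\<^sub>n\<close>, of the fraction of
  permutations of \<open>[k]\<close> having \<open>r\<close> fixed points. Each weight tends to \<open>0\<close> as \<open>n \<rightarrow> \<infinity>\<close>,
  while the fractions tend to \<open>1 / (e r!)\<close> as \<open>k \<rightarrow> \<infinity>\<close>.
\<close>

section \<open>Fixed points of permutations\<close>

text \<open>Conjugation by a bijection from \<open>{1..card S}\<close> onto \<open>S\<close> carries
  fixed points to fixed points, so only the cardinality matters.\<close>

lemma card_fixpoint_free_permutations:
  assumes "finite S"
  shows "card {p. p permutes S \<and> (\<forall>i\<in>S. p i \<noteq> i)} = derangement_number (card S)"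
proof -
  obtain f where f: "bij_betw f {1..card S} S"
    using ex_bij_betw_nat_finite_1[OF assms] by blast
  let ?A = "{1..card S}"
  let ?g = "\<lambda>\<pi> x. if x \<in> S then f (\<pi> (inv_into ?A f x)) else x"
  have "bij_betw ?g {p \<in> {p. p permutes ?A}. \<forall>i\<in>?A. p i \<noteq> i}
      {p \<in> {p. p permutes S}. \<forall>i\<in>S. p i \<noteq> i}"
  proof (rule bij_betw_Collect[OF bij_betw_permutations[OF f]])
    fix p assume "p \<in> {p. p permutes ?A}"
    then have p: "p i \<in> ?A" if "i \<in> ?A" for i
      using that permutes_in_image[of p ?A i] by simp
    have "?g p (f i) = f (p i)" if "i \<in> ?A" for i
      using that f by (simp add: bij_betw_inv_into_left bij_betw_apply)
    moreover have "f (p i) = f i \<longleftrightarrow> p i = i" if "i \<in> ?A" for i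
      using that p[OF that] f by (metis bij_betw_imp_inj_on inj_on_eq_iff)
    moreover have "S = f ` ?A" using f by (simp add: bij_betw_imp_surj_on)
    ultimately show "(\<forall>i\<in>S. ?g p i \<noteq> i) \<longleftrightarrow> (\<forall>i\<in>?A. p i \<noteq> i)"
      by (metis (no_types, lifting) image_iff)
  qed
  then show ?thesis
    unfolding derangement_number_def by (auto dest: bij_betw_same_card)
qed

text \<open>\<open>permutes\<close> demands the identity outside the set, so the permutations of
  \<open>A\<close> with fixed set \<open>F\<close> are, as functions, exactly the fixed-point-free
  permutations of \<open>A - F\<close>.\<close>

lemma card_permutations_fixed_set:
  assumes "finite A" "F \<subseteq> A"
  shows "card {p. p permutes A \<and> {i \<in> A. p i = i} = F} = derangement_number (card A - card F)"
proof -
  have "{p. p permutes A \<and> {i \<in> A. p i = i} = F}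
      = {p. p permutes (A - F) \<and> (\<forall>i\<in>A - F. p i \<noteq> i)}"
    using assms by (auto intro: permutes_superset permutes_subset dest: permutes_not_in)
  then show ?thesis
    using assms by (simp add: card_fixpoint_free_permutations card_Diff_subset finite_subset)
qed

text \<open>The permutations are grouped by their fixed set, an \<open>r\<close>-subset of
  \<open>A\<close>. For \<open>r > card A\<close> the binomial vanishes, so the truncated
  subtraction is harmless.\<close>

lemma card_permutations_fixed_points:
  assumes "finite A"
  shows "card {p. p permutes A \<and> card {i \<in> A. p i = i} = r}
       = (card A choose r) * derangement_number (card A - r)"
proof -
  let ?\<F> = "{F. F \<subseteq> A \<and> card F = r}"
  have "{p. p permutes A \<and> card {i \<in> A. p i = i} = r}
      = (\<Union>F\<in>?\<F>. {p. p permutes A \<and> {i \<in> A. p i = i} = F})"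
    by auto
  also have "card \<dots> = (\<Sum>F\<in>?\<F>. card {p. p permutes A \<and> {i \<in> A. p i = i} = F})"
    using assms by (intro card_UN_disjoint) (auto simp: finite_permutations)
  also have "\<dots> = (\<Sum>F\<in>?\<F>. derangement_number (card A - r))"
    using assms by (intro sum.cong) (auto simp: card_permutations_fixed_set)
  finally show ?thesis
    using assms by (simp add: n_subsets)
qed

lemma fact_eq_sum_derangement_number:
  "fact n = (\<Sum>r\<le>n. (n choose r) * derangement_number (n - r))"
proof -
  let ?A = "{..<n}"
  have "card {i \<in> ?A. p i = i} \<le> n" for p :: "nat \<Rightarrow> nat"
    using card_mono[of ?A "{i \<in> ?A. p i = i}"] by auto
  then have "{p. p permutes ?A} = (\<Union>r\<in>{..n}. {p. p permutes ?A \<and> card {i \<in> ?A. p i = i} = r})"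
    by auto
  then have "card {p. p permutes ?A}
      = (\<Sum>r\<le>n. card {p. p permutes ?A \<and> card {i \<in> ?A. p i = i} = r})"
    by (simp only:, intro card_UN_disjoint) (auto simp: finite_permutations)
  then show ?thesis
    by (simp only: card_permutations[OF card_lessThan] card_permutations_fixed_points
        card_lessThan finite_lessThan)
qed

text \<open>In exponential generating functions the preceding recurrence reads
  \<open>exp(x) * D(x) = 1 / (1 - x)\<close>. After multiplication by \<open>exp(-x)\<close>, the
  factor \<open>1 / (1 - x)\<close>, here \<open>Abs_fps (\<lambda>_. 1)\<close>, turns coefficients
  into partial sums.\<close>

lemma derangement_number_eq:
  "real (derangement_number n) / fact n = (\<Sum>i\<le>n. (-1) ^ i / fact i)"
proof -
  let ?e = "\<lambda>n. real (derangement_number n) / fact n"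
  have "fps_exp (1::real) * Abs_fps ?e = Abs_fps (\<lambda>_. 1)"
  proof (rule fps_ext)
    fix n
    have "(\<Sum>r=0..n. 1 / fact r * ?e (n - r))
        = (\<Sum>r\<le>n. real ((n choose r) * derangement_number (n - r)) / fact n)"
      unfolding atMost_atLeast0
      by (intro sum.cong) (auto simp: binomial_fact)
    also have "\<dots> = 1"
      unfolding sum_divide_distrib[symmetric] of_nat_sum[symmetric]
        fact_eq_sum_derangement_number[symmetric] by simp
    finally show "fps_nth (fps_exp 1 * Abs_fps ?e) n = fps_nth (Abs_fps (\<lambda>_. 1)) n"
      by (simp add: fps_mult_nth)
  qed
  then have "fps_exp (-1) * (fps_exp 1 * Abs_fps ?e) = fps_exp (-1) * Abs_fps (\<lambda>_. 1)"
    by simp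
  then have "Abs_fps ?e = fps_exp (-1) * Abs_fps (\<lambda>_. 1)"
    by (simp add: mult.assoc[symmetric] fps_exp_add_mult[symmetric])
  then have "fps_nth (Abs_fps ?e) n = fps_nth (fps_exp (-1) * Abs_fps (\<lambda>_. 1)) n"
    by simp
  then show ?thesis
    by (simp add: fps_mult_nth atMost_atLeast0)
qed

lemma derangement_number_limit:
  "(\<lambda>n. real (derangement_number n) / fact n) \<longlonglongrightarrow> exp (-1)"
proof -
  have "(\<lambda>i. (-1) ^ i /\<^sub>R fact i) sums exp (-1 :: real)"
    by (rule exp_converges)
  then have "(\<lambda>i. (-1) ^ i / fact i) sums exp (-1 :: real)"
    by (simp add: divide_inverse mult.commute)
  then show ?thesis
    unfolding derangement_number_eq by (simp add: sums_def_le)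
qed

section \<open>Ordered set partitions\<close>

text \<open>First case of the Stirling recurrence: the new point is a block of its own, and deleting
  that block leaves an arbitrary partition of \<open>A\<close>.\<close>

lemma partition_on_insert_point_singleton:
  assumes "x \<notin> A" and fin: "finite A"
  shows "{P. partition_on (insert x A) P \<and> {x} \<in> P \<and> card P = Suc k}
       = insert {x} ` {P. partition_on A P \<and> card P = k}"
proof (intro equalityI subsetI)
  fix P assume "P \<in> {P. partition_on (insert x A) P \<and> {x} \<in> P \<and> card P = Suc k}"
  then have P: "partition_on (insert x A) P" "{x} \<in> P" "card P = Suc k" by auto
  obtain Q where Q: "P = insert {x} Q" "{x} \<notin> Q" using P(2) by (meson mk_disjoint_insert)
  have "finite P" using P(1) fin by (meson finite_elements finite_insert)
  moreover have "disjnt {x} (\<Union>Q)" using Q P(1)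
    by (auto simp: partition_on_def disjoint_def disjnt_def)
  then have "partition_on A Q"
    using P(1) Q partition_on_insert[of "{x}" Q "insert x A"] assms by (simp)
  ultimately show "P \<in> insert {x} ` {P. partition_on A P \<and> card P = k}"
    using Q P by auto
next
  fix P assume "P \<in> insert {x} ` {P. partition_on A P \<and> card P = k}"
  then obtain Q where Q: "P = insert {x} Q" "partition_on A Q" "card Q = k" by auto
  have "disjnt {x} (\<Union>Q)" using Q assms partition_onD1 by fastforce
  moreover have "finite Q" "{x} \<notin> Q" using Q assms finite_elements partition_onD1 by blast+
  ultimately show "P \<in> {P. partition_on (insert x A) P \<and> {x} \<in> P \<and> card P = Suc k}"
    using Q assms partition_on_insert[of "{x}" Q "insert x A"] by auto
qed

text \<open>Second case of the recurrence: the new point joins a marked block \<open>B\<close>, and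
  the choice of \<open>B\<close> accounts for the factor \<open>k\<close>. The inverse removes
  \<open>x\<close> from the block containing it.\<close>

lemma partition_on_insert_point_bij:
  assumes x: "x \<notin> A" and "finite A"
  shows "bij_betw (\<lambda>(P, B). insert (insert x B) (P - {B}))
      (SIGMA P : {P. partition_on A P \<and> card P = k}. P)
      {P. partition_on (insert x A) P \<and> {x} \<notin> P \<and> card P = k}"
proof (rule bij_betwI[where g = "\<lambda>P. let C = (THE C. C \<in> P \<and> x \<in> C)
    in (insert (C - {x}) (P - {C}), C - {x})"])
  let ?f = "\<lambda>(P, B). insert (insert x B) (P - {B})"
  let ?g = "\<lambda>P. let C = (THE C. C \<in> P \<and> x \<in> C) in (insert (C - {x}) (P - {C}), C - {x})"
  let ?S = "SIGMA P : {P. partition_on A P \<and> card P = k}. P"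
  let ?T = "{P. partition_on (insert x A) P \<and> {x} \<notin> P \<and> card P = k}"
  have *: "?f (P, B) \<in> ?T \<and> ?g (?f (P, B)) = (P, B)"
    if "partition_on A P" "card P = k" "B \<in> P" for P B
  proof -
    have fin: "finite P" using that assms finite_elements by blast
    have xP: "x \<notin> C" if "C \<in> P" for C
      using that \<open>partition_on A P\<close> x partition_onD1 by fastforce
    then have new: "insert x B \<notin> P" by auto
    have dis: "B \<inter> C = {}" if "C \<in> P - {B}" for C
      using that \<open>partition_on A P\<close> \<open>B \<in> P\<close> by (auto simp: partition_on_def disjoint_def)
    have B: "B \<noteq> {}" "B \<subseteq> A" using that by (auto simp: partition_on_def)
    have P: "insert B (P - {B}) = P" using that by (simp add: insert_absorb)
    have dB: "disjnt B (\<Union>(P - {B}))" using dis by (auto simp: disjnt_def)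
    then have "partition_on (A - B) (P - {B})"
      using partition_on_insert[OF dB, of A] that(1) unfolding P by blast
    moreover have "insert x A - insert x B = A - B" using x by auto
    ultimately have "partition_on (insert x A - insert x B) (P - {B})" by simp
    moreover have "insert x B \<subseteq> insert x A" "insert x B \<noteq> {}" using B(2) by auto
    moreover have "disjnt (insert x B) (\<Union>(P - {B}))"
      using dB xP by (auto simp: disjnt_def)
    ultimately have "partition_on (insert x A) (insert (insert x B) (P - {B}))"
      by (simp only: partition_on_insert simp_thms)
    then have "partition_on (insert x A) (?f (P, B))" by simp
    moreover have "insert x B \<noteq> {x}" using B(1) xP[OF that(3)] by blast
    then have "{x} \<notin> ?f (P, B)" using xP by blast
    moreover have "card (?f (P, B)) = k"
      using fin that new card_Suc_Diff1[OF fin that(3)] by simp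
    moreover have "(THE C. C \<in> ?f (P, B) \<and> x \<in> C) = insert x B"
      using xP by (intro the_equality) blast+
    moreover have "insert x B - {x} = B" using xP that by auto
    moreover have "insert x B \<notin> P - {B}" using new by blast
    ultimately show ?thesis using P by simp
  qed
  have *: "?f z \<in> ?T \<and> ?g (?f z) = z" if z: "z \<in> ?S" for z
  proof -
    obtain P B where PB: "z = (P, B)" "partition_on A P" "card P = k" "B \<in> P"
      using z by blast
    show ?thesis unfolding PB(1) by (rule *[OF PB(2-4)])
  qed
  show "?f \<in> ?S \<rightarrow> ?T" using * by (intro funcsetI) (rule conjunct1)
  show "?g (?f z) = z" if "z \<in> ?S" for z using *[OF that] by (rule conjunct2)
  have **: "?g P \<in> ?S \<and> ?f (?g P) = P" if "P \<in> ?T" for P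
  proof -
    have P: "partition_on (insert x A) P" "{x} \<notin> P" "card P = k" using that by auto
    have fin: "finite P" using P assms by (meson finite_elements finite_insert)
    obtain C where C: "C \<in> P" "x \<in> C" using P(1) by (auto simp: partition_on_def)
    have un: "D = C" if "D \<in> P" "x \<in> D" for D
      using that P(1) C by (auto simp: partition_on_def disjoint_def)
    then have the: "(THE C. C \<in> P \<and> x \<in> C) = C"
      using C un by (intro the_equality) blast+
    define B where "B = C - {x}"
    have CB: "C = insert x B" using C B_def by auto
    \<comment> \<open>Since \<open>{x}\<close> is not a block, something remains of \<open>C\<close>
      when \<open>x\<close> is removed.\<close>
    have "C \<noteq> {x}" using C P(2) by blast
    then have B: "B \<noteq> {}" "x \<notin> B" "B \<subseteq> A" using P(1) C B_def by (auto simp: partition_on_def)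
    have PC: "insert C (P - {C}) = P" using C by (simp add: insert_absorb)
    have dC: "disjnt C (\<Union>(P - {C}))" using P(1) C(1) by (auto simp: partition_on_def disjoint_def disjnt_def)
    then have "partition_on (insert x A - C) (P - {C})"
      using partition_on_insert[OF dC, of "insert x A"] P(1) unfolding PC by blast
    moreover have "insert x A - C = A - B" using x CB by auto
    ultimately have "partition_on (A - B) (P - {C})" by simp
    moreover have dB: "disjnt B (\<Union>(P - {C}))" using dC CB by (auto simp: disjnt_def)
    ultimately have "partition_on A (insert B (P - {C}))"
      using B(1,3) by (simp only: partition_on_insert simp_thms)
    moreover have nB: "B \<notin> P - {C}" using dB B by (auto simp: disjnt_def)
    then have "card (insert B (P - {C})) = k"
      using fin P(3) card_Suc_Diff1[OF fin C(1)] by simp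
    moreover have "insert B (P - {C}) - {B} = P - {C}" using nB by auto
    ultimately show ?thesis unfolding the Let_def B_def[symmetric] by (simp add: CB[symmetric] insert_absorb C(1))
  qed
  show "?g \<in> ?T \<rightarrow> ?S" using ** by (intro funcsetI) (rule conjunct1)
  show "?f (?g P) = P" if "P \<in> ?T" for P using **[OF that] by (rule conjunct2)
qed

text \<open>The two cases for the new point, alone or joining a block, yield the two terms of the
  recurrence defining \<open>Stirling\<close>.\<close>

lemma card_partitions_eq_Stirling:
  assumes "finite A"
  shows "card {P. partition_on A P \<and> card P = k} = Stirling (card A) k"
  using assms
proof (induction A arbitrary: k rule: finite_induct)
  case empty
  have "{P :: 'a set set. partition_on {} P \<and> card P = k} = (if k = 0 then {{}} else {})"
    by (auto simp: partition_on_empty)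
  then show ?case by (simp only:) (cases k; simp)
next
  case (insert x A)
  show ?case
  proof (cases k)
    case 0
    \<comment> \<open>A partition of a nonempty set has a block; finiteness excludes the convention
      that infinite sets have cardinality 0.\<close>
    have "finite P" "P \<noteq> {}" if "partition_on (insert x A) P" for P
      using finite_elements[OF _ that] insert.hyps(1) that by (simp, auto simp: partition_on_def)
    then show ?thesis using 0 insert.hyps by (auto simp: card_eq_0_iff)
  next
    case (Suc j)
    let ?S = "{P. partition_on (insert x A) P \<and> {x} \<in> P \<and> card P = Suc j}"
    let ?T = "{P. partition_on (insert x A) P \<and> {x} \<notin> P \<and> card P = Suc j}"
    have fin: "finite {P. partition_on B P \<and> R P}" if "finite B" for B :: "'a set" and R
      using finitely_many_partition_on[OF that] by (rule rev_finite_subset) auto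
    have "{x} \<notin> P" if "partition_on A P" for P
      using that insert.hyps by (auto simp: partition_on_def)
    then have "inj_on (insert {x}) {P. partition_on A P \<and> card P = j}"
      by (intro inj_onI) (metis (no_types, lifting) insert_ident mem_Collect_eq)
    then have S: "card ?S = Stirling (card A) j"
      using insert by (simp add: partition_on_insert_point_singleton card_image)
    have "card ?T = card (SIGMA P : {P. partition_on A P \<and> card P = Suc j}. P)"
      by (rule bij_betw_same_card[symmetric, OF partition_on_insert_point_bij]) (use insert in auto)
    also have "\<dots> = (\<Sum>P\<in>{P. partition_on A P \<and> card P = Suc j}. card P)"
      using fin[OF insert.hyps(1)] insert.hyps finite_elements by (intro card_SigmaI) auto
    also have "\<dots> = Suc j * Stirling (card A) (Suc j)"
      using insert.IH[of "Suc j"] by simp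
    finally have T: "card ?T = Suc j * Stirling (card A) (Suc j)" .
    have "{P. partition_on (insert x A) P \<and> card P = k} = ?S \<union> ?T" using Suc by auto
    then have "card {P. partition_on (insert x A) P \<and> card P = k} = card ?S + card ?T"
      using insert.hyps by (simp only:, intro card_Un_disjoint fin) auto
    then show ?thesis using S T Suc insert.hyps by simp
  qed
qed

section \<open>Orderings of a partition and their fixed blocks\<close>

text \<open>\<open>set\<close> forgets repetitions, so distinctness of the blocks is demanded
  separately.\<close>

definition ordered_set_partitions :: "'a set \<Rightarrow> 'a set list set" where
  "ordered_set_partitions A = {C. distinct C \<and> partition_on A (set C)}"

text \<open>Blocks sharing a minimum would intersect. Distinct minima make the order by
  \<open>sort_key Min\<close> depend only on the set of blocks.\<close>

lemma inj_on_Min_partition: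
  fixes A :: "'a::linorder set"
  assumes "finite A" "partition_on A P"
  shows "inj_on Min P"
proof (rule inj_onI)
  fix X Y assume XY: "X \<in> P" "Y \<in> P" "Min X = Min Y"
  have "Min Z \<in> Z" if "Z \<in> P" for Z
    using that assms by (intro Min_in) (auto simp: partition_on_def intro: finite_subset)
  then have "Min X \<in> X \<inter> Y" using XY by (metis IntI)
  then show "X = Y" using XY assms by (auto simp: partition_on_def disjoint_def)
qed

text \<open>Position \<open>i\<close> of \<open>permute_list p B\<close> holds
  \<open>B ! p i\<close>, which determines \<open>p i\<close> as \<open>B\<close> has no
  repetitions. Conversely, repetition-free lists with the same set have equal multisets and are
  rearrangements of each other.\<close>

lemma bij_betw_permute_list:
  assumes "distinct B"
  shows "bij_betw (\<lambda>p. permute_list p B) {p. p permutes {..<length B}}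
           {C. distinct C \<and> set C = set B}"
proof (rule bij_betw_imageI)
  show "inj_on (\<lambda>p. permute_list p B) {p. p permutes {..<length B}}"
  proof (intro inj_onI ext)
    fix p q i
    assume p: "p \<in> {p. p permutes {..<length B}}" and q: "q \<in> {p. p permutes {..<length B}}"
      and eq: "permute_list p B = permute_list q B"
    show "p i = q i"
    proof (cases "i < length B")
      case True
      then have "B ! p i = B ! q i" using p q eq by (metis mem_Collect_eq permute_list_nth)
      moreover have "p i < length B" "q i < length B"
        using True p q permutes_in_image[of _ "{..<length B}"] by auto
      ultimately show ?thesis using assms by (simp add: nth_eq_iff_index_eq)
    next
      case False
      then show ?thesis using p q by (simp add: permutes_not_in)
    qed
  qed
  show "(\<lambda>p. permute_list p B) ` {p. p permutes {..<length B}} = {C. distinct C \<and> set C = set B}"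
  proof (intro equalityI subsetI)
    fix C assume "C \<in> {C. distinct C \<and> set C = set B}"
    then have "mset C = mset B" using assms set_eq_iff_mset_eq_distinct by blast
    then obtain p where "p permutes {..<length B}" "permute_list p B = C"
      by (rule mset_eq_permutation)
    then show "C \<in> (\<lambda>p. permute_list p B) ` {p. p permutes {..<length B}}" by blast
  qed (use assms in auto)
qed

text \<open>Let \<open>B\<close> list the blocks by increasing minimum. Every ordering is
  \<open>permute_list p B\<close> for one \<open>p\<close>, and its block at \<open>i\<close> is
  fixed exactly when \<open>B ! p i = B ! i\<close>, that is, when \<open>p i = i\<close>.\<close>

lemma card_orderings_num_fixed_blocks:
  assumes "finite A" "partition_on A P"
  shows "card {C. distinct C \<and> set C = P \<and> num_fixed_blocks C = r}
       = (card P choose r) * derangement_number (card P - r)"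
proof -
  have "finite P" using assms finite_elements by blast
  then obtain C0 where C0: "distinct C0" "set C0 = P" using finite_distinct_list by blast
  define B where "B = sort_key Min C0"
  have B: "distinct B" "set B = P" "sorted (map Min B)" "length B = card P"
    using C0 distinct_card[OF C0(1)] by (simp_all add: B_def)
  \<comment> \<open>All orderings of \<open>P\<close> sort to the same list because their keys are
    distinct.\<close>
  have sort: "sort_key Min C = B" if "distinct C" "set C = P" for C
    using that B inj_on_Min_partition[OF assms]
    by (intro sort_key_inj_key_eq) (auto simp: set_eq_iff_mset_eq_distinct)
  have "bij_betw (\<lambda>p. permute_list p B)
     {p \<in> {p. p permutes {..<length B}}. card {i \<in> {..<length B}. p i = i} = r}
     {C \<in> {C. distinct C \<and> set C = set B}. num_fixed_blocks C = r}"
  proof (rule bij_betw_Collect[OF bij_betw_permute_list[OF B(1)]])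
    fix p assume "p \<in> {p. p permutes {..<length B}}"
    then have p: "p permutes {..<length B}" by simp
    have "B ! p i = B ! i \<longleftrightarrow> p i = i" if "i < length B" for i
      using that B(1) p permutes_in_image[of p "{..<length B}" i] by (simp add: nth_eq_iff_index_eq)
    then have "{i. i < length (permute_list p B) \<and> permute_list p B ! i = sort_key Min (permute_list p B) ! i}
        = {i \<in> {..<length B}. p i = i}"
      using p B sort[of "permute_list p B"] by (auto simp: permute_list_nth)
    then show "num_fixed_blocks (permute_list p B) = r \<longleftrightarrow> card {i \<in> {..<length B}. p i = i} = r"
      by (simp add: num_fixed_blocks_def)
  qed
  then have "card {C. distinct C \<and> set C = P \<and> num_fixed_blocks C = r}
      = card {p. p permutes {..<length B} \<and> card {i \<in> {..<length B}. p i = i} = r}"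
    using B(2) by (auto dest!: bij_betw_same_card)
  then show ?thesis
    using card_permutations_fixed_points[of "{..<length B}" r] B(4) by simp
qed

lemma sum_partitions_by_card:
  fixes g :: "nat \<Rightarrow> nat"
  assumes "finite A"
  shows "(\<Sum>P | partition_on A P. g (card P)) = (\<Sum>k=0..card A. Stirling (card A) k * g k)"
proof -
  have fin: "finite {P. partition_on A P}" using assms by (rule finitely_many_partition_on)
  have le: "card P \<le> card A" if P: "partition_on A P" for P
  proof (rule ccontr)
    assume "\<not> card P \<le> card A"
    then have "card {Q. partition_on A Q \<and> card Q = card P} = 0"
      using assms by (simp add: card_partitions_eq_Stirling)
    moreover have "finite {Q. partition_on A Q \<and> card Q = card P}"
      by (rule finite_subset[OF _ fin]) auto
    ultimately show False using P by auto
  qed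
  have "(\<Sum>P | partition_on A P. g (card P))
      = (\<Sum>k=0..card A. \<Sum>P | P \<in> {P. partition_on A P} \<and> card P = k. g (card P))"
    using le fin by (intro sum.group[symmetric]) auto
  also have "\<dots> = (\<Sum>k=0..card A. Stirling (card A) k * g k)"
    using assms by (intro sum.cong) (auto simp: card_partitions_eq_Stirling[symmetric])
  finally show ?thesis .
qed

lemma finite_ordered_set_partitions:
  assumes "finite A"
  shows "finite (ordered_set_partitions A)"
proof (rule finite_subset)
  show "ordered_set_partitions A \<subseteq> {C. set C \<subseteq> Pow A \<and> distinct C}"
    by (auto simp: ordered_set_partitions_def partition_on_def)
  show "finite {C. set C \<subseteq> Pow A \<and> distinct C}"
    using assms by (intro finite_subset_distinct) auto
qed

text \<open>Orderings are grouped by the underlying partition. The condition \<open>Q\<close> is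
  left open to serve both the total count and the count by fixed blocks.\<close>

lemma card_ordered_set_partitions_by_underlying:
  assumes "finite A"
  shows "card {C \<in> ordered_set_partitions A. Q C}
       = (\<Sum>P | partition_on A P. card {C. distinct C \<and> set C = P \<and> Q C})"
proof -
  have fin: "finite {C. distinct C \<and> set C = P \<and> Q C}" if "partition_on A P" for P
    using finite_ordered_set_partitions[OF assms] that
    by (rule_tac finite_subset) (auto simp: ordered_set_partitions_def)
  have "{C \<in> ordered_set_partitions A. Q C}
      = (\<Union>P\<in>{P. partition_on A P}. {C. distinct C \<and> set C = P \<and> Q C})"
    by (auto simp: ordered_set_partitions_def)
  also have "card \<dots> = (\<Sum>P | partition_on A P. card {C. distinct C \<and> set C = P \<and> Q C})"
    using fin finitely_many_partition_on[OF assms] by (intro card_UN_disjoint) auto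
  finally show ?thesis .
qed

lemma card_ordered_set_partitions:
  assumes "finite A"
  shows "card (ordered_set_partitions A) = fubini (card A)"
proof -
  have "card (ordered_set_partitions A) = (\<Sum>P | partition_on A P. card {C. distinct C \<and> set C = P})"
    using card_ordered_set_partitions_by_underlying[OF assms, of "\<lambda>_. True"] by simp
  also have "\<dots> = (\<Sum>P | partition_on A P. fact (card P))"
  proof (rule sum.cong)
    fix P assume "P \<in> {P. partition_on A P}"
    moreover have "{C. distinct C \<and> set C = P} = permutations_of_set P"
      by (auto simp: permutations_of_set_def)
    ultimately show "card {C. distinct C \<and> set C = P} = fact (card P)"
      using finite_elements[OF assms] by simp
  qed simp
  also have "\<dots> = fubini (card A)"
    by (simp add: sum_partitions_by_card[OF assms] fubini_def mult.commute)
  finally show ?thesis .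
qed

lemma card_ordered_set_partitions_num_fixed_blocks:
  assumes "finite A"
  shows "card {C \<in> ordered_set_partitions A. num_fixed_blocks C = r}
       = (\<Sum>k=0..card A. Stirling (card A) k * ((k choose r) * derangement_number (k - r)))"
  unfolding card_ordered_set_partitions_by_underlying[OF assms]
    sum_partitions_by_card[OF assms, of "\<lambda>k. (k choose r) * derangement_number (k - r)", symmetric]
  by (intro sum.cong) (auto simp: card_orderings_num_fixed_blocks[OF assms])

section \<open>Unit-interval parking functions\<close>

lemma interval_index_exists:
  fixes \<nu> :: "nat \<Rightarrow> nat"
  assumes "\<nu> 0 \<le> y" "y < \<nu> m"
  shows "\<exists>j<m. \<nu> j \<le> y \<and> y < \<nu> (Suc j)"
  using assms(2)
proof (induction m)
  case 0
  then show ?case using assms(1) by simp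
next
  case (Suc m)
  then show ?case by (cases "y < \<nu> m") (auto intro: less_SucI)
qed

lemma interval_index_unique:
  fixes \<nu> :: "nat \<Rightarrow> nat"
  assumes "mono_on {..m} \<nu>" "j < m" "l < m" "\<nu> j \<le> y" "y < \<nu> (Suc j)" "\<nu> l \<le> y" "y < \<nu> (Suc l)"
  shows "j = l"
proof (rule ccontr)
  assume "j \<noteq> l"
  then consider "Suc j \<le> l" | "Suc l \<le> j" by linarith
  then show False
  proof cases
    case 1
    then have "\<nu> (Suc j) \<le> \<nu> l" using assms by (intro mono_onD[OF assms(1)]) auto
    then show False using assms by simp
  next
    case 2
    then have "\<nu> (Suc l) \<le> \<nu> j" using assms by (intro mono_onD[OF assms(1)]) auto
    then show False using assms by simp
  qed
qed

text \<open>
  The clause about \<open>c\<close> says that a car parking one spot past its preference was displaced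
  by an earlier car.
\<close>

definition unit_outcome :: "nat \<Rightarrow> (nat \<Rightarrow> nat) \<Rightarrow> (nat \<Rightarrow> nat) \<Rightarrow> bool" where
  "unit_outcome n a s \<longleftrightarrow> bij_betw s {1..n} {1..n} \<and>
     (\<forall>i\<in>{1..n}. a i = s i \<or> (1 \<le> a i \<and> Suc (a i) = s i \<and> (\<exists>c\<in>{1..n}. c < i \<and> s c = a i)))"

text \<open>With displacement at most one, the only spot a car can have passed over is its
  preference. The sequential rule thus reduces to one earlier car parked there, and injectivity on
  the finite set \<open>{1..n}\<close> makes the outcome a bijection.\<close>

lemma UPF_iff_unit_outcome:
  "a \<in> UPF n \<longleftrightarrow> a \<in> extensional {1..n} \<and> (\<exists>s. unit_outcome n a s)"
proof (intro iffI conjI; (elim conjE exE)?)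
  assume "a \<in> UPF n"
  then obtain s where a: "a \<in> {1..n} \<rightarrow>\<^sub>E {1..n}" and s: "parks n a s"
    and unit: "\<forall>i\<in>{1..n}. int (s i) - int (a i) \<in> {0, 1}"
    by (auto simp: UPF_def parking_functions_def)
  show "a \<in> extensional {1..n}" using a by (auto simp: PiE_def)
  have inj: "inj_on s {1..n}"
  proof (rule linorder_inj_onI)
    fix i j assume "i < j" "i \<in> {1..n}" "j \<in> {1..n}"
    then show "s i \<noteq> s j" using s unfolding parks_def by (metis atLeastAtMost_iff atLeastLessThan_iff image_eqI)
  qed auto
  have "s ` {1..n} \<subseteq> {1..n}"
  proof
    fix p assume "p \<in> s ` {1..n}"
    then obtain i where i: "i \<in> {1..n}" "p = s i" by blast
    then have "a i \<in> {1..n}" "s i \<in> {a i..n}" using a s by (auto simp: parks_def)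
    then show "p \<in> {1..n}" using i by auto
  qed
  then have "bij_betw s {1..n} {1..n}"
    using inj endo_inj_surj[of "{1..n}" s] by (simp add: bij_betw_def)
  moreover have "a i = s i \<or> (1 \<le> a i \<and> Suc (a i) = s i \<and> (\<exists>c\<in>{1..n}. c < i \<and> s c = a i))"
    if i: "i \<in> {1..n}" for i
  proof -
    have "a i = s i \<or> Suc (a i) = s i" using unit i by fastforce
    moreover have "1 \<le> a i" using a i by auto
    moreover have "\<exists>c\<in>{1..n}. c < i \<and> s c = a i" if "Suc (a i) = s i"
    proof -
      have "a i \<in> {a i..<s i}" using that by simp
      then have "a i \<in> s ` {1..<i}" using s i by (auto simp: parks_def)
      then show ?thesis using i by auto
    qed
    ultimately show ?thesis by blast
  qed
  ultimately show "\<exists>s. unit_outcome n a s" unfolding unit_outcome_def by blast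
next
  fix s assume ext: "a \<in> extensional {1..n}" and s: "unit_outcome n a s"
  have bij: "bij_betw s {1..n} {1..n}" using s by (simp add: unit_outcome_def)
  have unit: "a i = s i \<or> (1 \<le> a i \<and> Suc (a i) = s i \<and> (\<exists>c\<in>{1..n}. c < i \<and> s c = a i))"
    if "i \<in> {1..n}" for i using s that by (simp add: unit_outcome_def)
  have range: "s i \<in> {1..n}" if "i \<in> {1..n}" for i using bij that by (rule bij_betw_apply)
  have "a i \<in> {1..n}" if "i \<in> {1..n}" for i
    using unit[OF that] range[OF that] by auto
  then have "a \<in> {1..n} \<rightarrow>\<^sub>E {1..n}" using ext by (auto simp: PiE_def)
  moreover have "parks n a s"
    unfolding parks_def
  proof (intro ballI conjI)
    fix i assume i: "i \<in> {1..n}"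
    show "s i \<in> {a i..n}" using unit[OF i] range[OF i] by auto
    show "s i \<notin> s ` {1..<i}"
    proof
      assume "s i \<in> s ` {1..<i}"
      then obtain c where "c \<in> {1..<i}" "s c = s i" by force
      moreover from this have "c \<in> {1..n}" using i by auto
      moreover have "c \<noteq> i" using \<open>c \<in> {1..<i}\<close> by simp
      ultimately show False using bij i by (metis bij_betw_imp_inj_on inj_onD)
    qed
    fix t assume "t \<in> {a i..<s i}"
    then have "t = a i" "a i \<noteq> s i" using unit[OF i] by auto
    then obtain c where "c \<in> {1..n}" "c < i" "s c = t" using unit[OF i] by auto
    then show "t \<in> s ` {1..<i}" by auto
  qed
  moreover have "int (s i) - int (a i) \<in> {0, 1}" if "i \<in> {1..n}" for i
    using unit[OF that] by auto
  ultimately show "a \<in> UPF n"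
    unfolding UPF_def parking_functions_def by blast
qed

section \<open>Sorted preferences and block bounds\<close>

text \<open>Turns the condition on the rearrangement at index \<open>i\<close> into a condition on
  the single car parked at spot \<open>i\<close>.\<close>

lemma rearranged_eq_preference_at_spot:
  assumes s: "unit_outcome n a s" and c: "c \<in> {1..n}"
  shows "rearranged n a (s c) = a c"
proof -
  have bij: "bij_betw s {1..n} {1..n}" using s by (simp add: unit_outcome_def)
  define \<sigma> where "\<sigma> = inv_into {1..n} s"
  have \<sigma>: "bij_betw \<sigma> {1..n} {1..n}"
    unfolding \<sigma>_def using bij by (rule bij_betw_inv_into)
  have a\<sigma>: "a (\<sigma> p) = p \<or> Suc (a (\<sigma> p)) = p" if "p \<in> {1..n}" for p
  proof -
    have "\<sigma> p \<in> {1..n}" "s (\<sigma> p) = p"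
      using that bij \<sigma> by (auto simp: \<sigma>_def bij_betw_inv_into_right dest: bij_betw_apply)
    then show ?thesis using s unfolding unit_outcome_def by metis
  qed
  txt \<open>Read in the order of the spots, the preferences are already sorted.\<close>
  have "sort (map a [1..<Suc n]) = map (\<lambda>p. a (\<sigma> p)) [1..<Suc n]"
  proof (rule properties_for_sort)
    have "image_mset \<sigma> (mset_set {1..n}) = mset_set {1..n}"
      using \<sigma> by (simp add: image_mset_mset_set bij_betw_def)
    then have "image_mset a (image_mset \<sigma> (mset_set {1..n})) = image_mset a (mset_set {1..n})"
      by simp
    moreover have "mset [1..<Suc n] = mset_set {1..n}"
      by (simp only: mset_upt atLeastLessThanSuc_atLeastAtMost)
    ultimately show "mset (map (\<lambda>p. a (\<sigma> p)) [1..<Suc n]) = mset (map a [1..<Suc n])"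
      by (simp only: mset_map image_mset.compositionality comp_def)
    \<comment> \<open>The car at spot \<open>p\<close> prefers \<open>p\<close> or
      \<open>p - 1\<close>, hence
      \<open>a (\<sigma> p) \<le> p \<le> q - 1 \<le> a (\<sigma> q)\<close> for
      \<open>p < q\<close>.\<close>
    have "a (\<sigma> p) \<le> a (\<sigma> q)" if "p \<le> q" "p \<in> {1..n}" "q \<in> {1..n}" for p q
      using that a\<sigma>[of p] a\<sigma>[of q] by (cases "p = q") auto
    then show "sorted (map (\<lambda>p. a (\<sigma> p)) [1..<Suc n])"
      unfolding sorted_map by (intro sorted_wrt_mono_rel[OF _ sorted_upt]) auto
  qed
  moreover have "s c - 1 < length [1..<Suc n]" "[1..<Suc n] ! (s c - 1) = s c"
    using bij_betw_apply[OF bij c] by (auto simp del: upt_Suc)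
  moreover have "\<sigma> (s c) = c" using bij c by (simp add: \<sigma>_def bij_betw_inv_into_left)
  ultimately show ?thesis
    unfolding rearranged_def by (simp only: nth_map)
qed

text \<open>By the previous lemma the rearrangement has the entry \<open>i\<close> at
  \<open>i = s c\<close> exactly when car \<open>c\<close> got its preference; \<open>n + 1\<close>
  is the closing sentinel.\<close>

lemma block_bounds_set:
  assumes s: "unit_outcome n a s"
  shows "set (block_bounds n a) = insert (n + 1) {s c | c. c \<in> {1..n} \<and> a c = s c}"
proof -
  have bij: "bij_betw s {1..n} {1..n}" using s by (simp add: unit_outcome_def)
  have "{i \<in> {1..n}. rearranged n a i = i} = {s c | c. c \<in> {1..n} \<and> a c = s c}"
  proof (intro equalityI subsetI)
    fix i assume i: "i \<in> {i \<in> {1..n}. rearranged n a i = i}"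
    then have "i \<in> s ` {1..n}" using bij by (simp add: bij_betw_def)
    then obtain c where "c \<in> {1..n}" "i = s c" by blast
    then show "i \<in> {s c | c. c \<in> {1..n} \<and> a c = s c}"
      using i rearranged_eq_preference_at_spot[OF s] by auto
  next
    fix i assume "i \<in> {s c | c. c \<in> {1..n} \<and> a c = s c}"
    then obtain c where "c \<in> {1..n}" "i = s c" "a c = s c" by blast
    then show "i \<in> {i \<in> {1..n}. rearranged n a i = i}"
      using rearranged_eq_preference_at_spot[OF s] bij_betw_apply[OF bij] by simp
  qed
  then show ?thesis unfolding block_bounds_def by simp
qed

lemma block_bounds_strict_sorted: "sorted_wrt (<) (block_bounds n a)"
  by (auto simp: block_bounds_def sorted_wrt_append)

lemma block_bounds_less: "u < v \<Longrightarrow> v < length (block_bounds n a) \<Longrightarrow> block_bounds n a ! u < block_bounds n a ! v"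
  using block_bounds_strict_sorted[of n a] by (simp add: sorted_wrt_iff_nth_less)

lemma block_bounds_le: "u \<le> v \<Longrightarrow> v < length (block_bounds n a) \<Longrightarrow> block_bounds n a ! u \<le> block_bounds n a ! v"
  by (cases "u = v") (auto intro: less_imp_le[OF block_bounds_less])

lemma block_bounds_between:
  assumes "Suc j < length (block_bounds n a)"
    and "block_bounds n a ! j < p" "p < block_bounds n a ! Suc j"
  shows "p \<notin> set (block_bounds n a)"
proof
  assume "p \<in> set (block_bounds n a)"
  then obtain k where k: "k < length (block_bounds n a)" "block_bounds n a ! k = p"
    by (auto simp: in_set_conv_nth)
  consider "k \<le> j" | "Suc j \<le> k" by linarith
  then show False
  proof cases
    case 1
    then show False using block_bounds_le[of k j n a] assms k by simp
  next
    case 2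
    then show False using block_bounds_le[of "Suc j" k n a] assms k by simp
  qed
qed

lemma block_bounds_last: "block_bounds n a \<noteq> []" "block_bounds n a ! (length (block_bounds n a) - 1) = n + 1"
  by (simp_all add: block_bounds_def nth_append)

lemma length_blocks: "length (blocks n a) = length (block_bounds n a) - 1"
  by (simp add: blocks_def Let_def)

text \<open>The car at spot 1 cannot have been displaced, as its preference would be 0. For
  \<open>n = 0\<close> the list is \<open>[1]\<close>, the sentinel alone.\<close>

lemma block_bounds_first:
  assumes s: "unit_outcome n a s"
  shows "block_bounds n a ! 0 = 1"
proof (cases "n = 0")
  case True
  then show ?thesis by (simp add: block_bounds_def)
next
  case False
  let ?\<nu> = "block_bounds n a"
  have bij: "bij_betw s {1..n} {1..n}" using s by (simp add: unit_outcome_def)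
  have "1 \<in> {1..n}" using False by simp
  then obtain c where c: "c \<in> {1..n}" "s c = 1" using bij by (metis bij_betw_imp_surj_on imageE)
  then have "a c = s c" using s unfolding unit_outcome_def
    by (metis One_nat_def Suc_le_eq less_irrefl less_Suc_eq_le)
  then have "1 \<in> set ?\<nu>" unfolding block_bounds_set[OF s] using c by force
  then obtain k where "k < length ?\<nu>" "?\<nu> ! k = 1" by (auto simp: in_set_conv_nth)
  then have "?\<nu> ! 0 \<le> 1"
    using block_bounds_le[of 0 k n a] by simp
  moreover have "?\<nu> ! 0 \<in> set ?\<nu>" using block_bounds_last(1) by (intro nth_mem) auto
  then have "?\<nu> ! 0 \<ge> 1" unfolding block_bounds_set[OF s] using bij by (auto dest: bij_betw_apply)
  ultimately show ?thesis by simp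
qed

section \<open>Blocks as intervals of consecutive spots\<close>

text \<open>Blocks are defined by preferences but can be read off the spots: a displaced car moves
  one step onto a spot that is no bound, so it stays in its interval.\<close>

lemma blocks_nth_outcome:
  assumes s: "unit_outcome n a s" and j: "j < length (blocks n a)"
  shows "blocks n a ! j
       = {i \<in> {1..n}. block_bounds n a ! j \<le> s i \<and> s i < block_bounds n a ! Suc j}"
proof -
  let ?\<nu> = "block_bounds n a"
  have bij: "bij_betw s {1..n} {1..n}" using s by (simp add: unit_outcome_def)
  have nth: "blocks n a ! j = {i \<in> {1..n}. ?\<nu> ! j \<le> a i \<and> a i < ?\<nu> ! Suc j}"
    using j by (simp add: blocks_def Let_def)
  have "?\<nu> ! j \<le> a i \<and> a i < ?\<nu> ! Suc j \<longleftrightarrow> ?\<nu> ! j \<le> s i \<and> s i < ?\<nu> ! Suc j" if i: "i \<in> {1..n}" for i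
  proof (cases "a i = s i")
    case False
    then have Suc: "Suc (a i) = s i" using s i by (auto simp: unit_outcome_def)
    have "s i \<in> {1..n}" using bij i by (rule bij_betw_apply)
    \<comment> \<open>\<open>s\<close> is injective, so only car \<open>i\<close> could make
      \<open>s i\<close> a bound, and it was displaced.\<close>
    moreover have "a c \<noteq> s c" if "c \<in> {1..n}" "s c = s i" for c
      using that i False bij by (metis bij_betw_imp_inj_on inj_onD)
    ultimately have "s i \<notin> set ?\<nu>"
      unfolding block_bounds_set[OF s] by force
    moreover have "?\<nu> ! j \<in> set ?\<nu>" "?\<nu> ! Suc j \<in> set ?\<nu>"
      using j by (auto simp: length_blocks)
    ultimately have "?\<nu> ! j \<noteq> s i" "?\<nu> ! Suc j \<noteq> s i" by metis+
    then show ?thesis using Suc by linarith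
  qed simp
  then show ?thesis unfolding nth by blast
qed

text \<open>The first spot of block \<open>j\<close>, computed from the block sizes alone; for an
  ordered set partition, \<open>j = length C\<close> gives one past the last spot.\<close>

definition block_offset :: "'a set list \<Rightarrow> nat \<Rightarrow> nat" where
  "block_offset C j = Suc (\<Sum>l<j. card (C ! l))"

text \<open>The cars of block \<open>j\<close> fill the spots between two consecutive bounds. Its
  size is therefore a difference of bounds, and the sum of the sizes telescopes from the first bound
  1.\<close>

lemma blocks_structure:
  assumes s: "unit_outcome n a s"
  shows blocks_bij: "\<And>j. j < length (blocks n a) \<Longrightarrow>
      bij_betw s (blocks n a ! j) {block_bounds n a ! j ..< block_bounds n a ! Suc j}"
    and blocks_cover: "\<And>i. i \<in> {1..n} \<Longrightarrow> \<exists>j<length (blocks n a). i \<in> blocks n a ! j"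
    and block_offset_blocks: "\<And>j. j \<le> length (blocks n a) \<Longrightarrow>
      block_offset (blocks n a) j = block_bounds n a ! j"
proof -
  let ?\<nu> = "block_bounds n a" let ?C = "blocks n a"
  have bij: "bij_betw s {1..n} {1..n}" using s by (simp add: unit_outcome_def)
  have len: "length ?\<nu> = Suc (length ?C)"
    using block_bounds_last(1)[of n a] by (simp add: length_blocks)
  have mono: "?\<nu> ! j \<le> ?\<nu> ! l" if "j \<le> l" "l \<le> length ?C" for j l
    using that len by (intro block_bounds_le) auto
  have last: "?\<nu> ! length ?C = n + 1" using block_bounds_last(2)[of n a] len by simp
  have first: "?\<nu> ! 0 = 1" by (rule block_bounds_first[OF s])
  show bijC: "bij_betw s (?C ! j) {?\<nu> ! j ..< ?\<nu> ! Suc j}" if j: "j < length ?C" for j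
  proof (rule bij_betw_imageI)
    show "inj_on s (?C ! j)"
      using bij unfolding blocks_nth_outcome[OF s j]
      by (intro inj_on_subset[OF bij_betw_imp_inj_on[OF bij]]) auto
    have "\<exists>i\<in>{1..n}. s i = p" if "p \<in> {?\<nu> ! j ..< ?\<nu> ! Suc j}" for p
    proof -
      have "p \<in> {1..n}" using that mono[of 0 j] mono[of "Suc j" "length ?C"] j first last by auto
      then show ?thesis using bij by (metis bij_betw_imp_surj_on imageE)
    qed
    then show "s ` (?C ! j) = {?\<nu> ! j ..< ?\<nu> ! Suc j}"
      unfolding blocks_nth_outcome[OF s j] by (force simp: image_iff)
  qed
  show "\<exists>j<length ?C. i \<in> ?C ! j" if i: "i \<in> {1..n}" for i
  proof -
    have "s i \<in> {1..n}" using bij i by (rule bij_betw_apply)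
    then have "\<exists>j<length ?C. ?\<nu> ! j \<le> s i \<and> s i < ?\<nu> ! Suc j"
      using first last by (intro interval_index_exists) auto
    then show ?thesis using i blocks_nth_outcome[OF s] by auto
  qed
  show "block_offset ?C j = ?\<nu> ! j" if "j \<le> length ?C" for j
    using that
  proof (induction j)
    case 0
    then show ?case using first by (simp add: block_offset_def)
  next
    case (Suc j)
    have "card (?C ! j) = ?\<nu> ! Suc j - ?\<nu> ! j"
      using bij_betw_same_card[OF bijC[of j]] Suc.prems by simp
    moreover have "?\<nu> ! j \<le> ?\<nu> ! Suc j" using mono Suc.prems by simp
    moreover have "block_offset ?C (Suc j) = block_offset ?C j + card (?C ! j)"
      by (simp add: block_offset_def)
    ultimately show ?case using Suc by simp
  qed
qed

lemma blocks_in_ordered_set_partitions: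
  assumes s: "unit_outcome n a s"
  shows "blocks n a \<in> ordered_set_partitions {1..n}"
proof -
  let ?\<nu> = "block_bounds n a" let ?C = "blocks n a"
  have len: "length ?\<nu> = Suc (length ?C)"
    using block_bounds_last(1)[of n a] by (simp add: length_blocks)
  have less: "?\<nu> ! j < ?\<nu> ! l" if "j < l" "l \<le> length ?C" for j l
    using that len by (intro block_bounds_less) auto
  then have mono: "mono_on {..length ?C} (\<lambda>j. ?\<nu> ! j)"
    by (intro mono_onI) (metis atMost_iff le_less)
  have ne: "?C ! j \<noteq> {}" if "j < length ?C" for j
    using blocks_bij[OF s that] less[of j "Suc j"] that
    by (metis Suc_leI atLeastLessThan_empty_iff bij_betw_empty1 lessI not_le)
  have disj: "?C ! j \<inter> ?C ! l = {}" if "j < length ?C" "l < length ?C" "j \<noteq> l" for j l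
    using that interval_index_unique[OF mono, of j l] blocks_nth_outcome[OF s] by auto
  have "distinct ?C"
    unfolding distinct_conv_nth using ne disj by (metis Int_absorb)
  moreover have "partition_on {1..n} (set ?C)"
  proof (rule partition_onI)
    show "\<Union>(set ?C) = {1..n}"
    proof (intro equalityI subsetI)
      fix i assume "i \<in> \<Union>(set ?C)"
      then obtain j where "j < length ?C" "i \<in> ?C ! j" by (auto simp: in_set_conv_nth)
      then show "i \<in> {1..n}" using blocks_nth_outcome[OF s] by auto
    next
      fix i assume "i \<in> {1..n}"
      then show "i \<in> \<Union>(set ?C)" using blocks_cover[OF s, of i] by auto
    qed
    show "disjnt X Y" if "X \<in> set ?C" "Y \<in> set ?C" "X \<noteq> Y" for X Y
      using that disj unfolding disjnt_def in_set_conv_nth by metis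
    show "{} \<notin> set ?C" using ne by (auto simp: in_set_conv_nth)
  qed
  ultimately show ?thesis by (simp add: ordered_set_partitions_def)
qed

section \<open>Recovering the preferences from the blocks\<close>

text \<open>A car not on the first spot of its block was displaced by an earlier car on the
  preceding spot. Following these cars back from \<open>y\<close> reaches \<open>x\<close> through
  ever smaller labels; the induction is on the spot of \<open>y\<close>.\<close>

lemma outcome_mono_on_block:
  assumes s: "unit_outcome n a s" and j: "j < length (blocks n a)"
    and "x \<in> blocks n a ! j" "y \<in> blocks n a ! j" "s x < s y"
  shows "x < y"
  using assms(4,5)
proof (induction "s y" arbitrary: y rule: less_induct)
  case less
  let ?\<nu> = "block_bounds n a"
  have bij: "bij_betw s {1..n} {1..n}" using s by (simp add: unit_outcome_def)
  have x: "x \<in> {1..n}" "?\<nu> ! j \<le> s x"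
    and y: "y \<in> {1..n}" "s y < ?\<nu> ! Suc j"
    using assms(3) less.prems blocks_nth_outcome[OF s j] by auto
  have "s y \<notin> set ?\<nu>"
    using x y less.prems j by (intro block_bounds_between[of j]) (auto simp: length_blocks)
  then have "a y \<noteq> s y" using y unfolding block_bounds_set[OF s] by auto
  then obtain c where c: "c \<in> {1..n}" "c < y" "Suc (s c) = s y"
    using s y unfolding unit_outcome_def by metis
  then have cj: "c \<in> blocks n a ! j"
    using x y less.prems unfolding blocks_nth_outcome[OF s j] by auto
  show "x < y"
  proof (cases "s x = s c")
    case True
    then have "x = c" using bij x c by (meson bij_betw_imp_inj_on inj_onD)
    then show ?thesis using c by simp
  next
    case False
    then have "x < c" using less.hyps[of c] c cj less.prems by simp
    then show ?thesis using c by simp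
  qed
qed

text \<open>A block is parked in increasing order from its first spot, so the rank of
  \<open>i\<close> in the block gives its spot. All but the first car prefer one spot less; the
  truncated subtraction at rank 0 covers the first, which got its preference.\<close>

lemma preference_from_blocks:
  assumes s: "unit_outcome n a s" and j: "j < length (blocks n a)" and i: "i \<in> blocks n a ! j"
  shows "a i = block_offset (blocks n a) j + (card {x \<in> blocks n a ! j. x < i} - 1)"
proof -
  let ?\<nu> = "block_bounds n a" let ?B = "blocks n a ! j"
  have bij: "bij_betw s {1..n} {1..n}" using s by (simp add: unit_outcome_def)
  have bijB: "bij_betw s ?B {?\<nu> ! j ..< ?\<nu> ! Suc j}" by (rule blocks_bij[OF s j])
  have i': "i \<in> {1..n}" "?\<nu> ! j \<le> s i" "s i < ?\<nu> ! Suc j"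
    using i unfolding blocks_nth_outcome[OF s j] by auto
  have "{x \<in> ?B. x < i} = {x \<in> ?B. s x < s i}"
  proof (intro Collect_cong conj_cong refl iffI)
    fix x assume x: "x \<in> ?B" "x < i"
    then have "s x \<noteq> s i" using bijB i by (metis bij_betw_imp_inj_on inj_onD nat_neq_iff)
    moreover have "\<not> s i < s x" using outcome_mono_on_block[OF s j i x(1)] x(2) by auto
    ultimately show "s x < s i" by simp
  qed (use outcome_mono_on_block[OF s j _ i] in auto)
  moreover have "bij_betw s {x \<in> ?B. s x < s i} {p \<in> {?\<nu> ! j ..< ?\<nu> ! Suc j}. p < s i}"
    using bijB by (rule bij_betw_Collect) simp
  moreover have "{p \<in> {?\<nu> ! j ..< ?\<nu> ! Suc j}. p < s i} = {?\<nu> ! j ..< s i}"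
    using i' by auto
  ultimately have rank: "card {x \<in> ?B. x < i} = s i - ?\<nu> ! j"
    by (metis bij_betw_same_card card_atLeastLessThan)
  have off: "block_offset (blocks n a) j = ?\<nu> ! j" using block_offset_blocks[OF s] j by simp
  show ?thesis
  proof (cases "s i = ?\<nu> ! j")
    case True
    \<comment> \<open>The first spot of a block is a bound other than the sentinel, so the car on
      it, which is \<open>i\<close>, was not displaced.\<close>
    have "?\<nu> ! j \<in> set ?\<nu>" using j by (auto simp: length_blocks)
    moreover have "s i \<noteq> n + 1" using bij_betw_apply[OF bij i'(1)] by simp
    ultimately obtain c where "c \<in> {1..n}" "a c = s c" "s c = s i"
      unfolding block_bounds_set[OF s] True[symmetric] by auto
    moreover from this have "c = i" using bij i' by (meson bij_betw_imp_inj_on inj_onD)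
    ultimately show ?thesis unfolding rank off using True by simp
  next
    case False
    have "a i \<noteq> s i"
    proof
      assume "a i = s i"
      then have "s i \<in> set ?\<nu>" using i' unfolding block_bounds_set[OF s] by auto
      moreover have "s i \<notin> set ?\<nu>"
        using i' False j by (intro block_bounds_between[of j]) (auto simp: length_blocks)
      ultimately show False by contradiction
    qed
    then have "Suc (a i) = s i" using s i' unfolding unit_outcome_def by metis
    then show ?thesis unfolding rank off using False i' by simp
  qed
qed

text \<open>The formula for the preferences mentions only the blocks; as tuples are extensional,
  agreement on \<open>{1..n}\<close> suffices.\<close>

lemma inj_on_blocks: "inj_on (blocks n) (UPF n)"
proof (rule inj_onI)
  fix a b assume "a \<in> UPF n" "b \<in> UPF n" and eq: "blocks n a = blocks n b"
  then obtain s t where ext: "a \<in> extensional {1..n}" "b \<in> extensional {1..n}"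
    and s: "unit_outcome n a s" and t: "unit_outcome n b t"
    unfolding UPF_iff_unit_outcome by blast
  show "a = b"
  proof (rule extensionalityI[OF ext])
    fix i assume "i \<in> {1..n}"
    then obtain j where "j < length (blocks n a)" "i \<in> blocks n a ! j"
      using blocks_cover[OF s] by blast
    then show "a i = b i"
      using preference_from_blocks[OF s] preference_from_blocks[OF t] eq by metis
  qed
qed

lemma block_offset_last:
  assumes "finite A" "distinct C" "partition_on A (set C)"
  shows "block_offset C (length C) = card A + 1"
proof -
  have "(\<Sum>l<length C. card (C ! l)) = (\<Sum>X\<in>set C. card X)"
    using bij_betw_nth[OF assms(2) refl refl] by (rule sum.reindex_bij_betw)
  also have "\<dots> = card (\<Union>(set C))"
    using assms by (intro card_Union_disjoint[symmetric])
      (auto simp: partition_on_def intro: finite_subset)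
  finally show ?thesis using assms(3) by (simp add: block_offset_def partition_on_def)
qed

lemma block_offset_mono: "j \<le> l \<Longrightarrow> block_offset C j \<le> block_offset C l"
  by (auto simp: block_offset_def intro: sum_mono2)

section \<open>Every ordered set partition is realised\<close>

text \<open>The outcome is prescribed first: car \<open>i\<close> of rank \<open>r i\<close> in
  block \<open>J i\<close> gets spot \<open>\<nu> (J i) + r i\<close> and prefers the spot before
  it, or that very spot at rank 0. The cars of rank 0 are the block minima, so the bounds come out
  as the offsets.\<close>

lemma blocks_surj:
  assumes "C \<in> ordered_set_partitions {1..n}"
  shows "\<exists>a\<in>UPF n. blocks n a = C"
proof -
  have C: "distinct C" "partition_on {1..n} (set C)"
    using assms by (simp_all add: ordered_set_partitions_def)
  let ?m = "length C"
  define \<nu> where "\<nu> = block_offset C"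
  have \<nu>_Suc: "\<nu> (Suc j) = \<nu> j + card (C ! j)" for j by (simp add: \<nu>_def block_offset_def)
  have \<nu>_last: "\<nu> ?m = n + 1" using block_offset_last[OF _ C] by (simp add: \<nu>_def)
  have \<nu>_pos: "1 \<le> \<nu> j" for j by (simp add: \<nu>_def block_offset_def)
  have \<nu>_mono: "\<nu> j \<le> \<nu> l" if "j \<le> l" for j l using block_offset_mono[OF that] by (simp add: \<nu>_def)
  have \<nu>_unique: "j = l" if "j < ?m" "l < ?m" "\<nu> j \<le> y" "y < \<nu> (Suc j)" "\<nu> l \<le> y" "y < \<nu> (Suc l)" for j l y
    using \<nu>_mono by (intro interval_index_unique[OF _ that] mono_onI) auto
  have sub: "C ! j \<subseteq> {1..n}" and ne: "C ! j \<noteq> {}" if "j < ?m" for j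
    using C(2) that unfolding partition_on_def by (force dest: nth_mem)+
  have fin: "finite (C ! j)" if "j < ?m" for j using sub[OF that] finite_subset by blast
  have "\<exists>j. j < ?m \<and> i \<in> C ! j" if "i \<in> {1..n}" for i
    using that C(2) by (metis UnionE in_set_conv_nth partition_onD1)
  then obtain J where J: "\<And>i. i \<in> {1..n} \<Longrightarrow> J i < ?m \<and> i \<in> C ! J i" by metis
  have J_unique: "J i = j" if "j < ?m" "i \<in> C ! j" for i j
  proof -
    have "i \<in> {1..n}" using sub that by blast
    then have "i \<in> C ! J i \<inter> C ! j" "J i < ?m" using J that by auto
    then have "C ! J i = C ! j"
      using C(2) that nth_mem by (metis disjointD empty_iff partition_onD2)
    then show ?thesis using C(1) \<open>J i < ?m\<close> that(1) by (simp add: nth_eq_iff_index_eq)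
  qed

  define r where "r i = card {x \<in> C ! J i. x < i}" for i
  define s where "s i = \<nu> (J i) + r i" for i
  \<comment> \<open>Truncated subtraction: ranks 0 and 1 share the preference
    \<open>\<nu> (J i)\<close>, the first spot of the block.\<close>
  define a where "a = restrict (\<lambda>i. \<nu> (J i) + (r i - 1)) {1..n}"
  have r_less: "r i < card (C ! J i)" if "i \<in> {1..n}" for i
    unfolding r_def using J[OF that] fin by (intro psubset_card_mono) auto
  have r_mono: "r i < r i'" if "i < i'" "J i = J i'" "i \<in> {1..n}" "i' \<in> {1..n}" for i i'
    unfolding r_def that(2) using J[OF that(3)] J[OF that(4)] that(1,2) fin
    by (intro psubset_card_mono) auto
  have s_range: "\<nu> (J i) \<le> s i" "s i < \<nu> (Suc (J i))" if "i \<in> {1..n}" for i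
    using r_less[OF that] by (auto simp: s_def \<nu>_Suc)
  have a_range: "\<nu> (J i) \<le> a i" "a i < \<nu> (Suc (J i))" if "i \<in> {1..n}" for i
    using that r_less[OF that] by (auto simp: a_def \<nu>_Suc)
  have "inj_on s {1..n}"
  proof (rule linorder_inj_onI)
    fix i i' assume i: "i < i'" "i \<in> {1..n}" "i' \<in> {1..n}"
    show "s i \<noteq> s i'"
    proof
      assume eq: "s i = s i'"
      then have "J i = J i'"
        using \<nu>_unique[of "J i" "J i'" "s i"] s_range[OF i(2)] s_range[OF i(3)] J i by auto
      then show False using r_mono[OF i(1) _ i(2,3)] eq by (simp add: s_def)
    qed
  qed auto
  moreover have "s ` {1..n} \<subseteq> {1..n}"
  proof
    fix p assume "p \<in> s ` {1..n}"
    then obtain i where i: "i \<in> {1..n}" "p = s i" by blast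
    then show "p \<in> {1..n}"
      using s_range[of i] \<nu>_pos[of "J i"] \<nu>_mono[of "Suc (J i)" ?m] J[of i] \<nu>_last by auto
  qed
  ultimately have bij: "bij_betw s {1..n} {1..n}"
    using endo_inj_surj[of "{1..n}" s] by (simp add: bij_betw_def)
  have outcome: "unit_outcome n a s"
    unfolding unit_outcome_def
  proof (intro conjI ballI bij)
    fix i assume i: "i \<in> {1..n}"
    show "a i = s i \<or> (1 \<le> a i \<and> Suc (a i) = s i \<and> (\<exists>c\<in>{1..n}. c < i \<and> s c = a i))"
    proof (cases "r i = 0")
      case True
      then show ?thesis using i by (simp add: a_def s_def)
    next
      case False
      then have Suc: "Suc (a i) = s i" using i by (simp add: a_def s_def)
      \<comment> \<open>The displacing car is whichever car parks on the preferred spot. That spot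
        lies in the same block, so the car has smaller rank and thus a smaller label.\<close>
      have "1 \<le> a i" using a_range(1)[OF i] \<nu>_pos[of "J i"] by simp
      moreover have "s i \<le> n" using bij_betw_apply[OF bij i] by simp
      ultimately have "a i \<in> {1..n}" using Suc by simp
      then have "a i \<in> s ` {1..n}" using bij by (simp add: bij_betw_def)
      then obtain c where c: "c \<in> {1..n}" "s c = a i" by force
      then have Jc: "J c = J i"
        using \<nu>_unique[of "J c" "J i" "a i"] s_range[of c] a_range[OF i] J i by auto
      have "r c < r i" using c Suc Jc by (simp add: s_def)
      then have "c < i" using r_mono[of i c] Jc i c by (metis less_asym' linorder_neqE_nat)
      then show ?thesis using Suc c \<open>1 \<le> a i\<close> by blast
    qed
  qed
  then have "a \<in> UPF n" unfolding UPF_iff_unit_outcome by (auto simp: a_def)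
  moreover have "blocks n a = C"
  proof -
    have "\<nu> ` {..<?m} = {s c | c. c \<in> {1..n} \<and> a c = s c}"
    proof (intro equalityI subsetI)
      fix p assume "p \<in> \<nu> ` {..<?m}"
      then obtain j where j: "j < ?m" "p = \<nu> j" by auto
      define c where "c = Min (C ! j)"
      have c: "c \<in> C ! j" unfolding c_def using fin[OF j(1)] ne[OF j(1)] by (rule Min_in)
      then have "c \<in> {1..n}" and Jc: "J c = j" using sub[OF j(1)] J_unique[OF j(1)] by auto
      have "{x \<in> C ! j. x < c} = {}"
        using fin[OF j(1)] by (auto simp: c_def not_less)
      then have "r c = 0" by (simp add: r_def Jc)
      then have "p = s c" "a c = s c" using \<open>c \<in> {1..n}\<close> by (simp_all add: a_def s_def j Jc)
      then show "p \<in> {s c | c. c \<in> {1..n} \<and> a c = s c}" using \<open>c \<in> {1..n}\<close> by blast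
    next
      fix p assume "p \<in> {s c | c. c \<in> {1..n} \<and> a c = s c}"
      then obtain c where c: "c \<in> {1..n}" "p = s c" "a c = s c" by blast
      then have "r c = 0" by (cases "r c") (simp_all add: a_def s_def)
      then show "p \<in> \<nu> ` {..<?m}" using J c by (auto simp: s_def)
    qed
    moreover have "set (map \<nu> [0..<Suc ?m]) = insert (\<nu> ?m) (\<nu> ` {..<?m})"
      by (simp add: lessThan_atLeast0)
    ultimately have "set (block_bounds n a) = set (map \<nu> [0..<Suc ?m])"
      unfolding block_bounds_set[OF outcome] \<nu>_last by simp
    \<comment> \<open>No block is empty, so the offsets grow strictly; two strictly sorted lists
      with the same set coincide.\<close>
    moreover have "sorted_wrt (<) (map \<nu> [0..<Suc ?m])"
    proof -
      have "\<nu> j < \<nu> l" if "j < l" "l \<le> ?m" for j l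
      proof -
        have "\<nu> j < \<nu> (Suc j)"
          using that fin[of j] ne[of j] by (simp add: \<nu>_Suc card_gt_0_iff)
        also have "\<dots> \<le> \<nu> l" using that by (intro \<nu>_mono) simp
        finally show ?thesis .
      qed
      then show ?thesis by (simp add: sorted_wrt_iff_nth_less nth_append del: upt_Suc)
    qed
    ultimately have bounds: "block_bounds n a = map \<nu> [0..<Suc ?m]"
      by (intro strict_sorted_equal block_bounds_strict_sorted) auto
    show ?thesis
    proof (rule nth_equalityI)
      show len: "length (blocks n a) = ?m" by (simp add: length_blocks bounds)
      fix j assume "j < length (blocks n a)"
      then have j: "j < ?m" by (simp add: len)
      have "blocks n a ! j = {i \<in> {1..n}. \<nu> j \<le> s i \<and> s i < \<nu> (Suc j)}"
        using blocks_nth_outcome[OF outcome, of j] j by (simp add: len bounds nth_append del: upt_Suc)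
      also have "\<dots> = C ! j"
      proof (intro equalityI subsetI)
        fix i assume i: "i \<in> {i \<in> {1..n}. \<nu> j \<le> s i \<and> s i < \<nu> (Suc j)}"
        then have "J i = j" using \<nu>_unique[of "J i" j "s i"] s_range[of i] J[of i] j by auto
        then show "i \<in> C ! j" using J i by blast
      next
        fix i assume "i \<in> C ! j"
        then have "i \<in> {1..n}" "J i = j" using J_unique[OF j] sub[OF j] by blast+
        then show "i \<in> {i \<in> {1..n}. \<nu> j \<le> s i \<and> s i < \<nu> (Suc j)}" using s_range[of i] by auto
      qed
      finally show "blocks n a ! j = C ! j" .
    qed
  qed
  ultimately show ?thesis by blast
qed

lemma bij_betw_blocks: "bij_betw (blocks n) (UPF n) (ordered_set_partitions {1..n})"
proof (rule bij_betw_imageI[OF inj_on_blocks])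
  show "blocks n ` UPF n = ordered_set_partitions {1..n}"
  proof (intro equalityI subsetI)
    fix C assume "C \<in> blocks n ` UPF n"
    then show "C \<in> ordered_set_partitions {1..n}"
      using blocks_in_ordered_set_partitions by (auto simp: UPF_iff_unit_outcome)
  next
    fix C assume "C \<in> ordered_set_partitions {1..n}"
    then show "C \<in> blocks n ` UPF n"
      using blocks_surj by blast
  qed
qed

section \<open>The limit\<close>

text \<open>A Toeplitz averaging argument: \<open>q k\<close> is within \<open>e / 2\<close> of
  \<open>L\<close> for \<open>k \<ge> N\<close>, which costs at most \<open>e / 2\<close> as the
  weights sum to 1, while the finitely many \<open>k < N\<close> carry vanishing weight.\<close>

lemma weighted_average_tendsto:
  fixes w :: "nat \<Rightarrow> nat \<Rightarrow> real" and q :: "nat \<Rightarrow> real"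
  assumes nonneg: "\<And>n k. 0 \<le> w n k" and total: "\<And>n. (\<Sum>k=0..n. w n k) = 1"
    and null: "\<And>k. (\<lambda>n. w n k) \<longlonglongrightarrow> 0" and q: "q \<longlonglongrightarrow> L"
  shows "(\<lambda>n. \<Sum>k=0..n. w n k * q k) \<longlonglongrightarrow> L"
proof (rule LIMSEQ_I)
  fix e :: real assume "e > 0"
  then obtain N where N: "\<And>k. k \<ge> N \<Longrightarrow> \<bar>q k - L\<bar> < e / 2"
    using LIMSEQ_D[OF q, of "e / 2"] by auto
  have "(\<lambda>n. \<Sum>k<N. w n k * \<bar>q k - L\<bar>) \<longlonglongrightarrow> (\<Sum>k<N. 0 * \<bar>q k - L\<bar>)"
    by (intro tendsto_sum tendsto_mult null tendsto_const)
  then obtain M where M: "\<And>n. n \<ge> M \<Longrightarrow> (\<Sum>k<N. w n k * \<bar>q k - L\<bar>) < e / 2"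
    using LIMSEQ_D[of _ 0 "e / 2"] \<open>e > 0\<close> by fastforce
  have "norm ((\<Sum>k=0..n. w n k * q k) - L) < e" if "n \<ge> M" for n
  proof -
    have "(\<Sum>k=0..n. w n k * q k) - L = (\<Sum>k=0..n. w n k * (q k - L))"
      using total[of n] by (simp add: algebra_simps sum_subtractf sum_distrib_left[symmetric])
    also have "norm \<dots> \<le> (\<Sum>k=0..n. w n k * \<bar>q k - L\<bar>)"
      using nonneg by (intro sum_norm_le) (simp add: abs_mult)
    \<comment> \<open>Granting \<open>e / 2\<close> to the indices below \<open>N\<close> as well
      makes the second part exactly \<open>e / 2\<close> times the total weight 1.\<close>
    also have "\<dots> \<le> (\<Sum>k=0..n. (if k < N then w n k * \<bar>q k - L\<bar> else 0) + w n k * (e / 2))"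
    proof (rule sum_mono)
      fix k
      show "w n k * \<bar>q k - L\<bar> \<le> (if k < N then w n k * \<bar>q k - L\<bar> else 0) + w n k * (e / 2)"
      proof (cases "k < N")
        case True
        then show ?thesis using nonneg[of n k] \<open>e > 0\<close> by simp
      next
        case False
        then have "w n k * \<bar>q k - L\<bar> \<le> w n k * (e / 2)"
          by (intro mult_left_mono nonneg less_imp_le[OF N]) simp
        then show ?thesis using False by simp
      qed
    qed
    also have "\<dots> = (\<Sum>k=0..n. if k < N then w n k * \<bar>q k - L\<bar> else 0) + e / 2"
      using total[of n] by (simp add: sum.distrib sum_distrib_right[symmetric] sum_divide_distrib[symmetric])
    also have "(\<Sum>k=0..n. if k < N then w n k * \<bar>q k - L\<bar> else 0)
        = (\<Sum>k\<in>{0..n} \<inter> {..<N}. w n k * \<bar>q k - L\<bar>)"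
      by (subst sum.inter_restrict) auto
    also have "\<dots> \<le> (\<Sum>k<N. w n k * \<bar>q k - L\<bar>)"
      using nonneg by (intro sum_mono2) auto
    also have "\<dots> < e / 2" using M that by blast
    finally show ?thesis by simp
  qed
  then show "\<exists>M. \<forall>n\<ge>M. norm ((\<Sum>k=0..n. w n k * q k) - L) < e" by blast
qed

text \<open>The sharper bound \<open>k ^ n\<close> does not pass through the recurrence; the factor \<open>2\<close> does.\<close>

lemma fact_mult_Stirling_le: "fact k * Stirling n k \<le> (2 * k) ^ n"
proof (induction n k rule: Stirling.induct)
  case (4 n k)
  have "fact (Suc k) * Stirling (Suc n) (Suc k)
      = Suc k * (fact (Suc k) * Stirling n (Suc k) + fact k * Stirling n k)"
    by (simp add: algebra_simps)
  also have "\<dots> \<le> Suc k * ((2 * Suc k) ^ n + (2 * k) ^ n)"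
    using 4 by (intro mult_left_mono add_mono) auto
  also have "\<dots> \<le> Suc k * ((2 * Suc k) ^ n + (2 * Suc k) ^ n)"
    by (intro mult_left_mono add_mono power_mono) auto
  also have "\<dots> = (2 * Suc k) ^ Suc n" by simp
  finally show ?case .
qed auto

text \<open>The partition into singletons, \<open>k = n\<close>, alone contributes
  \<open>n!\<close>, enough to outgrow every exponential.\<close>

lemma fact_le_fubini: "fact n \<le> fubini n"
  using member_le_sum[of n "{0..n}" "\<lambda>k. fact k * Stirling n k"] by (simp add: fubini_def)

lemma fubini_pos: "fubini n > 0"
  using fact_le_fubini[of n] fact_gt_zero[of n, where ?'a = nat] by linarith

text \<open>For fixed \<open>k\<close> the numerator is at most \<open>(2 * k) ^ n\<close> and the
  denominator at least \<open>n!\<close>, so the quotient is bounded by a term of the exponential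
  series at \<open>2 * k\<close>.\<close>

lemma fact_mult_Stirling_over_fubini_tendsto_0:
  "(\<lambda>n. fact k * real (Stirling n k) / real (fubini n)) \<longlonglongrightarrow> 0"
proof (rule tendsto_sandwich[of "\<lambda>_. 0"])
  show "(\<lambda>n. inverse (fact n) * (2 * real k) ^ n) \<longlonglongrightarrow> 0"
    by (rule summable_LIMSEQ_zero[OF summable_exp])
  have "fact k * real (Stirling n k) / real (fubini n) \<le> (2 * real k) ^ n / fact n" for n
  proof (rule frac_le)
    show "fact k * real (Stirling n k) \<le> (2 * real k) ^ n"
      using of_nat_mono[OF fact_mult_Stirling_le[of k n], where ?'a = real] by simp
    show "fact n \<le> real (fubini n)"
      using of_nat_mono[OF fact_le_fubini[of n], where ?'a = real] by simp
  qed auto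
  then show "\<forall>\<^sub>F n in sequentially. fact k * real (Stirling n k) / real (fubini n)
      \<le> inverse (fact n) * (2 * real k) ^ n"
    by (simp add: divide_inverse mult.commute)
qed auto

text \<open>With \<open>k + r\<close> in place of \<open>k\<close> the factorials cancel, leaving
  \<open>1 / r!\<close> times the fraction of derangements among the permutations of
  \<open>k\<close> points.\<close>

lemma fixed_point_fraction_limit:
  "(\<lambda>k. real ((k choose r) * derangement_number (k - r)) / fact k) \<longlonglongrightarrow> exp (-1) / fact r"
proof (rule LIMSEQ_offset[of _ r])
  have "real ((k + r choose r) * derangement_number (k + r - r)) / fact (k + r)
      = real (derangement_number k) / fact k / fact r" for k
    by (simp add: binomial_fact field_simps)
  then show "(\<lambda>k. real ((k + r choose r) * derangement_number (k + r - r)) / fact (k + r))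
      \<longlonglongrightarrow> exp (-1) / fact r"
    by (simp only:) (intro tendsto_divide derangement_number_limit tendsto_const, simp)
qed

lemma fixed_block_fraction_limit:
  "(\<lambda>n. real (\<Sum>k=0..n. Stirling n k * ((k choose r) * derangement_number (k - r))) / real (fubini n))
     \<longlonglongrightarrow> exp (-1) / fact r"
proof -
  \<comment> \<open>\<open>w n k\<close> is the probability that a uniform ordered set partition of
    \<open>{1..n}\<close> has \<open>k\<close> blocks, and \<open>q k\<close> the fraction of
    permutations of \<open>k\<close> points with \<open>r\<close> fixed points.\<close>
  define w where "w n k = fact k * real (Stirling n k) / real (fubini n)" for n k
  define q where "q k = real ((k choose r) * derangement_number (k - r)) / fact k" for k
  have "(\<lambda>n. \<Sum>k=0..n. w n k * q k) \<longlonglongrightarrow> exp (-1) / fact r"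
  proof (rule weighted_average_tendsto)
    show "(\<Sum>k=0..n. w n k) = 1" for n
    proof -
      have "(\<Sum>k=0..n. w n k) = real (fubini n) / real (fubini n)"
        unfolding w_def sum_divide_distrib[symmetric] by (simp add: fubini_def)
      then show ?thesis using fubini_pos[of n] by simp
    qed
    show "q \<longlonglongrightarrow> exp (-1) / fact r"
      unfolding q_def by (rule fixed_point_fraction_limit)
    show "(\<lambda>n. w n k) \<longlonglongrightarrow> 0" for k
      unfolding w_def by (rule fact_mult_Stirling_over_fubini_tendsto_0)
  qed (simp add: w_def)
  moreover have "(\<Sum>k=0..n. w n k * q k) =
    real (\<Sum>k=0..n. Stirling n k * ((k choose r) * derangement_number (k - r))) / real (fubini n)" for n
    unfolding of_nat_sum sum_divide_distrib by (intro sum.cong) (auto simp: w_def q_def)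
  ultimately show ?thesis by simp
qed

section \<open>From point masses to weak convergence\<close>

text \<open>For a natural-valued variable the distribution function at \<open>x\<close> is the
  finite sum of the point masses up to \<open>x\<close>, so convergence of the masses gives
  convergence of the distribution functions at every point, jumps included.\<close>

lemma weak_conv_m_nat_valued:
  fixes f :: "nat \<Rightarrow> 'a \<Rightarrow> nat" and g :: "'b \<Rightarrow> nat" and X :: "nat \<Rightarrow> 'a pmf"
  assumes "\<And>r. (\<lambda>n. measure_pmf.prob (X n) {a. f n a = r}) \<longlonglongrightarrow> measure_pmf.prob Y {y. g y = r}"
  shows "weak_conv_m (\<lambda>n. distr (measure_pmf (X n)) borel (\<lambda>a. real (f n a)))
           (distr (measure_pmf Y) borel (\<lambda>y. real (g y)))"
proof -
  have cdf: "cdf (distr (measure_pmf Z) borel (\<lambda>z. real (h z))) x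
      = (\<Sum>r | real r \<le> x. measure_pmf.prob Z {z. h z = r})" for Z :: "'c pmf" and h x
  proof -
    have fin: "finite {r. real r \<le> x}"
      by (rule finite_subset[of _ "{..nat \<lfloor>x\<rfloor>}"]) (auto simp: le_nat_floor)
    have "cdf (distr (measure_pmf Z) borel (\<lambda>z. real (h z))) x
        = measure_pmf.prob Z (\<Union>r\<in>{r. real r \<le> x}. {z. h z = r})"
      unfolding cdf_def by (subst measure_distr) (auto intro!: arg_cong[where f = "measure_pmf.prob Z"])
    also have "\<dots> = (\<Sum>r | real r \<le> x. measure_pmf.prob Z {z. h z = r})"
      using fin by (intro measure_pmf.finite_measure_finite_Union) (auto simp: disjoint_family_on_def)
    finally show ?thesis .
  qed
  show ?thesis
    unfolding weak_conv_m_def weak_conv_def cdf by (intro allI impI tendsto_sum assms)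
qed

text \<open>The bijection onto ordered set partitions lets both the event and the sample space be
  counted there; the denominator is the Fubini number.\<close>

lemma prob_fix_count:
  "measure_pmf.prob (pmf_of_set (UPF n)) {a. fix_count n a = r}
     = real (\<Sum>k=0..n. Stirling n k * ((k choose r) * derangement_number (k - r))) / real (fubini n)"
proof -
  have "bij_betw (blocks n) {a \<in> UPF n. fix_count n a = r}
      {C \<in> ordered_set_partitions {1..n}. num_fixed_blocks C = r}"
    using bij_betw_blocks by (rule bij_betw_Collect) (simp add: fix_count_def)
  then have "card {a \<in> UPF n. fix_count n a = r}
      = (\<Sum>k=0..n. Stirling n k * ((k choose r) * derangement_number (k - r)))"
    using card_ordered_set_partitions_num_fixed_blocks[of "{1..n}" r]
    by (simp add: bij_betw_same_card)
  moreover have "card (UPF n) = fubini n"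
    using bij_betw_same_card[OF bij_betw_blocks] card_ordered_set_partitions[of "{1..n}"] by simp
  ultimately show ?thesis
    by (simp add: measure_pmf_of_set[OF UPF_nonempty finite_UPF] Int_def)
qed

theorem corollary4p6:
  shows "weak_conv_m
           (\<lambda>n. distr (measure_pmf (pmf_of_set (UPF n))) borel (\<lambda>a. real (fix_count n a)))
           (distr (measure_pmf (poisson_pmf 1)) borel real)
       \<and> (\<forall>r::nat. (\<lambda>n. measure_pmf.prob (pmf_of_set (UPF n)) {a. fix_count n a = r})
                      \<longlonglongrightarrow> exp (-1) / fact r)
       \<and> (\<forall>n. measure_pmf.prob (pmf_of_set (UPF n)) {a. fix_count n a = 0}
                = real (deranged_bell n) / real (fubini n))
       \<and> (\<lambda>n. real (deranged_bell n) / real (fubini n)) \<longlonglongrightarrow> exp (-1)"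
proof -
  have lim: "(\<lambda>n. measure_pmf.prob (pmf_of_set (UPF n)) {a. fix_count n a = r})
      \<longlonglongrightarrow> exp (-1) / fact r" for r
    unfolding prob_fix_count by (rule fixed_block_fraction_limit)
  \<comment> \<open>At \<open>r = 0\<close> the binomial coefficient is 1 and the numerator is the
    deranged Bell number.\<close>
  have zero: "measure_pmf.prob (pmf_of_set (UPF n)) {a. fix_count n a = 0}
      = real (deranged_bell n) / real (fubini n)" for n
    unfolding prob_fix_count deranged_bell_def by (simp add: mult.commute)
  have "measure_pmf.prob (poisson_pmf 1) {y. y = r} = exp (-1) / fact r" for r
    using measure_pmf_single[of "poisson_pmf 1" r] by simp
  then have "weak_conv_m
           (\<lambda>n. distr (measure_pmf (pmf_of_set (UPF n))) borel (\<lambda>a. real (fix_count n a)))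
           (distr (measure_pmf (poisson_pmf 1)) borel (\<lambda>y. real y))"
    using lim by (intro weak_conv_m_nat_valued) simp
  moreover have "(\<lambda>n. real (deranged_bell n) / real (fubini n)) \<longlonglongrightarrow> exp (-1)"
    using lim[of 0] unfolding zero by simp
  ultimately show ?thesis using lim zero by simp
qed

end
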